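(* Let $p>1$, $n\geq 2$, $\alpha\geq 0$, $R>0$, and let $f_1,f_2$, $g_1,g_2,g_3$, $h_1,h_2,h_3$ be functions on $[0,\infty)$ such that: (B1) each $f_i,g_j,h_j$ is continuous, non-decreasing in $[0,\infty)$ and positive in $(0,\infty)$; (B2) each $g_j,h_j$ is differentiable in $[0,\infty)$, and $g_1,g_2,h_1,h_2$ are increasing in $(0,\infty)$; (B3) for each $j=1,2,3$, the quotient $Q_j(s,t)=g_j(st)/h_j(t)$ is non-increasing in $t$ for all $s\geq 1$, $t>0$; (B5) $g_j(t)\geq h_j(t)$ for all $t>0$ and $j=1,2,3$. Suppose that $(u,v)$ and $(u_0,v_0)$ are non-constant radial solutions of $$\Delta_p u = f_1(|x|)\, g_1(v)\, |\nabla u|^{\alpha}, \qquad \Delta_p v = f_2(|x|)\, g_2(v)\, g_3(|\nabla u|) \qquad \text{in } B_R$$ and $$\Delta_p u_0 = f_1(|x|)\, h_1(v_0)\, |\nabla u_0|^{\alpha}, \qquad \Delta_p v_0 = f_2(|x|)\, h_2(v_0)\, h_3(|\nabla u_0|) \qquad \text{in } B_R,$$ respectively, which are positive for all $0<r<R$. Suppose also that $u(0),v(0)>0$ and $$u_0(0)=v_0(0)=0,\qquad \lim_{r\to0^+}\frac{u_0(r)}{u_0'(r)}<\infty,\qquad \lim_{r\to0^+}\frac{v_0(r)}{v_0'(r)}<\infty .$$ Then each of the quotients $$\mathcal U(r)=\frac{u(r)}{u_0(r)},\qquad \mathcal V(r)=\frac{v(r)}{v_0(r)},\qquad \mathcal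 W(r)=\frac{u'(r)}{u_0'(r)},\qquad \mathcal Y(r)=\frac{v'(r)}{v_0'(r)}$$ is decreasing throughout the interval $(0,R)$.
   Context: $\Delta_p u=\operatorname{div}(|\nabla u|^{p-2}\nabla u)$ is the $p$-Laplace operator, and $B_R\subset\mathbb R^n$ is the open ball of radius $R$ centred at the origin. "Increasing" and "decreasing" are meant strictly. Radial functions are written as functions of $r=|x|$, and $'$ denotes $d/dr$. A radial solution $(u,v)$ of a system $\Delta_p u = F_1$, $\Delta_p v=F_2$ in $B_R$, where $F_1=f_1(|x|)\,G_1(v)\,|\nabla u|^{\alpha}$ and $F_2=f_2(|x|)\,G_2(v)\,G_3(|\nabla u|)$ with either $G_j=g_j$ for $j=1,2,3$ or $G_j=h_j$ for $j=1,2,3$, satisfies the corresponding radial equations $$[r^{n-1}u'(r)|u'(r)|^{p-2}]'=r^{n-1}F_1,\qquad [r^{n-1}v'(r)|v'(r)|^{p-2}]'=r^{n-1}F_2,$$ for $0<r<R$, where $F_1,F_2$ are the right-hand sides evaluated with $|x|=r$, $|\nabla u|=|u'(r)|$, together with $u'(0)=v'(0)=0$. "Positive for all $0<r<R$" means that both components are positive for all $0<r<R$.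
   Formalization: "Non-constant" is read as: none of u, v, u_0, v_0 is constant on any ball B_ρ, 0<ρ≤R; for solutions merely non-constant on B_R the claim fails (if 0<α<p−1, u may be constant near the centre, so u'/u_0' is 0 there and later positive). *)

theory Defs
  imports "HOL-Analysis.Analysis"
begin

(* |t|^a with the convention |t|^0 = 1 for all t (in HOL, 0 powr 0 = 0): for a = 0 the
   gradient factor must be absent also where the gradient vanishes. *)
definition abs_pow :: "real \<Rightarrow> real \<Rightarrow> real" where
  "abs_pow a t = (if a = 0 then 1 else \<bar>t\<bar> powr a)"

(* The radial profiles (u, v) of a radial solution of
     Delta_p u = f1(|x|) G1(v) |grad u|^alpha,   Delta_p v = f2(|x|) G2(v) G3(|grad u|)
   in the ball B_R of R^n.  Only the restrictions of u, v to [0,R) are relevant: the derivative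
   at 0 is one-sided.  Where w' = 0, the flux w' |w'|^(p-2) is 0 for every p > 1, as it should be. *)
definition radial_solution ::
  "nat \<Rightarrow> real \<Rightarrow> real \<Rightarrow> real \<Rightarrow> (real \<Rightarrow> real) \<Rightarrow> (real \<Rightarrow> real) \<Rightarrow>
   (real \<Rightarrow> real) \<Rightarrow> (real \<Rightarrow> real) \<Rightarrow> (real \<Rightarrow> real) \<Rightarrow>
   (real \<Rightarrow> real) \<Rightarrow> (real \<Rightarrow> real) \<Rightarrow> bool" where
  "radial_solution n p \<alpha> R f1 f2 G1 G2 G3 u v \<longleftrightarrow>
     (u has_real_derivative 0) (at 0 within {0..<R}) \<and>
     (v has_real_derivative 0) (at 0 within {0..<R}) \<and>
     (\<forall>r\<in>{0<..<R}.
        u differentiable (at r) \<and> v differentiable (at r) \<and>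
        ((\<lambda>s. s ^ (n - 1) * deriv u s * \<bar>deriv u s\<bar> powr (p - 2)) has_real_derivative
           r ^ (n - 1) * (f1 r * G1 (v r) * abs_pow \<alpha> (deriv u r))) (at r) \<and>
        ((\<lambda>s. s ^ (n - 1) * deriv v s * \<bar>deriv v s\<bar> powr (p - 2)) has_real_derivative
           r ^ (n - 1) * (f2 r * G2 (v r) * G3 \<bar>deriv u r\<bar>)) (at r))"

(* Non-constancy of a radial function is meant at the centre: it is constant on no ball B_rho.
   Merely excluding functions that are constant on all of B_R would admit "dead core" solutions
   when 0 < alpha < p - 1: u equal to u(0) on some B_rho and increasing afterwards.  For these
   u'/u0' vanishes on (0,rho) and is not decreasing. *)
definition nonconstant_radial :: "real \<Rightarrow> (real \<Rightarrow> real) \<Rightarrow> bool" where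
  "nonconstant_radial R w \<longleftrightarrow> (\<forall>\<rho>\<in>{0<..R}. \<not> w constant_on {0..<\<rho>})"

end

theory Submission
  imports Defs
begin

text \<open>
  For increasing profiles the flux \<open>r^(n-1) w'^(p-1)\<close> vanishes at the centre, and after raising the
  flux of \<open>u\<close> to the power \<open>\<kappa> = 1 - \<alpha>/(p-1)\<close> the gradient term drops out of the first equation.
  (Positivity of \<open>\<kappa>\<close> is forced by the existence of a solution that is non-constant at the centre.)
  So if \<open>v/v0 \<ge> 1\<close> is decreasing on \<open>(0,b]\<close>, the quotient of the derivatives of the two powers is
  \<open>g1(v)/h1(v0)\<close>, which decreases by (B3), and the monotone form of l'Hopital's rule shows that
  \<open>W = u'/u0' \<ge> 1\<close> decreases. As \<open>u0'\<close> increases, the same rule applied to the fluxes of \<open>v\<close> and \<open>v0\<close>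
  shows that \<open>Y = v'/v0' > 1\<close> decreases. Then \<open>v - Y(b) v0\<close> increases from \<open>v(0) > 0\<close>, so that
  \<open>v/v0 > Y > 1\<close> at \<open>b\<close>; but \<open>v/v0 > Y\<close> is exactly the condition for \<open>v/v0\<close> to decrease. Since
  \<open>v/v0 > max Y 1\<close> holds near the centre, by the finiteness of \<open>lim v0/v0'\<close>, it therefore holds up to \<open>R\<close>.
\<close>

section \<open>Monotonicity from signs of derivatives, and a monotone form of l'Hopital's
  rule\<close>

text \<open>Only the limit from the right enters, because \<open>deriv w 0\<close> is two-sided and
  not controlled by the equation. Passing through \<open>r/2\<close> keeps the result strict, as the
  limit preserves only \<open>F s \<le> F (r/2)\<close>.\<close>

lemma tendsto_less_if_deriv_pos:
  fixes F D :: "real \<Rightarrow> real"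
  assumes lim: "(F \<longlongrightarrow> l) (at_right 0)" and "0 < r"
    and deriv: "\<And>s. 0 < s \<Longrightarrow> s < r \<Longrightarrow> (F has_real_derivative D s) (at s)"
    and cont: "isCont F r"
    and pos: "\<And>s. 0 < s \<Longrightarrow> s < r \<Longrightarrow> D s > 0"
  shows "l < F r"
proof -
  have incr: "F a < F b" if "0 < a" "a < b" "b \<le> r" for a b
  proof (rule DERIV_pos_imp_increasing_open[OF \<open>a < b\<close>])
    show "\<exists>y. (F has_real_derivative y) (at x) \<and> 0 < y" if "a < x" "x < b" for x
      using deriv[of x] pos[of x] that \<open>0 < a\<close> \<open>b \<le> r\<close> by fastforce
    show "continuous_on {a..b} F"
    proof (rule continuous_at_imp_continuous_on, intro ballI)
      fix x assume "x \<in> {a..b}"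
      then show "isCont F x"
        using cont DERIV_isCont[OF deriv[of x]] that by (cases "x = r") auto
    qed
  qed
  have "\<forall>\<^sub>F s in at_right 0. F s \<le> F (r/2)"
    unfolding eventually_at_right_field
    using incr[of _ "r/2"] \<open>0 < r\<close> by (intro exI[of _ "r/2"]) (auto intro: less_imp_le)
  then have "l \<le> F (r/2)"
    by (intro tendsto_upperbound[OF lim]) auto
  also have "\<dots> < F r"
    using incr[of "r/2" r] \<open>0 < r\<close> by simp
  finally show ?thesis .
qed

lemma strict_antimono_on_if_deriv_neg:
  fixes F D :: "real \<Rightarrow> real"
  assumes deriv: "\<And>s. a < s \<Longrightarrow> s < b \<Longrightarrow> (F has_real_derivative D s) (at s)"
    and neg: "\<And>s. a < s \<Longrightarrow> s < b \<Longrightarrow> D s < 0"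
    and cont: "isCont F b"
  shows "strict_antimono_on {a<..b} F"
proof (rule monotone_onI)
  fix x y assume xy: "x \<in> {a<..b}" "y \<in> {a<..b}" "x < y"
  show "F x > F y"
  proof (rule DERIV_neg_imp_decreasing_open[OF \<open>x < y\<close>])
    show "\<exists>z. (F has_real_derivative z) (at t) \<and> z < 0" if "x < t" "t < y" for t
      using deriv[of t] neg[of t] that xy by fastforce
    show "continuous_on {x..y} F"
    proof (rule continuous_at_imp_continuous_on, intro ballI)
      fix t assume "t \<in> {x..y}"
      then show "isCont F t"
        using cont DERIV_isCont[OF deriv[of t]] xy by (cases "t = b") auto
    qed
  qed
qed

text \<open>For fixed r, \<open>F - k r * G\<close> has derivative
  \<open>(k s - k r) * G' s > 0\<close> on \<open>(0,r)\<close> and limit 0 at the centre, so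
  \<open>F r > k r * G r\<close>. This inequality is also what makes the derivative of
  \<open>F / G\<close> negative.\<close>

lemma monotone_lhopital:
  fixes F G G' k :: "real \<Rightarrow> real"
  assumes F0: "(F \<longlongrightarrow> 0) (at_right 0)" and G0: "(G \<longlongrightarrow> 0) (at_right 0)"
    and dF: "\<And>r. 0 < r \<Longrightarrow> r \<le> b \<Longrightarrow> (F has_real_derivative k r * G' r) (at r)"
    and dG: "\<And>r. 0 < r \<Longrightarrow> r \<le> b \<Longrightarrow> (G has_real_derivative G' r) (at r)"
    and G'_pos: "\<And>r. 0 < r \<Longrightarrow> r \<le> b \<Longrightarrow> G' r > 0"
    and k: "strict_antimono_on {0<..b} k"
  shows "strict_antimono_on {0<..b} (\<lambda>r. F r / G r)"
    and "\<And>r. 0 < r \<Longrightarrow> r \<le> b \<Longrightarrow> F r / G r > k r"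
proof -
  have G_pos: "G r > 0" if "0 < r" "r \<le> b" for r
    by (rule tendsto_less_if_deriv_pos[OF G0 \<open>0 < r\<close>, of G'])
       (use that dG G'_pos in \<open>auto intro: DERIV_isCont\<close>)
  have gt: "F r - k r * G r > 0" if "0 < r" "r \<le> b" for r
  proof (rule tendsto_less_if_deriv_pos[of "\<lambda>s. F s - k r * G s", OF _ \<open>0 < r\<close>])
    show "((\<lambda>s. F s - k r * G s) \<longlongrightarrow> 0) (at_right 0)"
      using tendsto_diff[OF F0 tendsto_mult_left[OF G0, of "k r"]] by simp
    have D: "((\<lambda>s. F s - k r * G s) has_real_derivative (k s - k r) * G' s) (at s)"
      if "0 < s" "s \<le> r" for s
      using that \<open>r \<le> b\<close> by (auto intro!: derivative_eq_intros dF dG simp: algebra_simps)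
    show "isCont (\<lambda>s. F s - k r * G s) r"
      using D[of r] \<open>0 < r\<close> by (auto intro: DERIV_isCont)
    show "((\<lambda>s. F s - k r * G s) has_real_derivative (k s - k r) * G' s) (at s)"
      if "0 < s" "s < r" for s using D[of s] that by simp
    show "(k s - k r) * G' s > 0" if "0 < s" "s < r" for s
      using monotone_onD[OF k, of s r] G'_pos[of s] that \<open>r \<le> b\<close> by simp
  qed
  then show "F r / G r > k r" if "0 < r" "r \<le> b" for r
    using that G_pos[of r] gt[of r] by (simp add: field_simps)
  have D: "((\<lambda>r. F r / G r) has_real_derivative - (G' r * (F r - k r * G r) / (G r * G r))) (at r)"
    if "0 < r" "r \<le> b" for r
    using G_pos[OF that] that
    by (auto intro!: derivative_eq_intros dF dG simp: field_simps)
  show "strict_antimono_on {0<..b} (\<lambda>r. F r / G r)"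
  proof (cases "0 < b")
    case True
    show ?thesis
    proof (rule strict_antimono_on_if_deriv_neg)
      fix r assume r: "0 < r" "r < b"
      show "((\<lambda>r. F r / G r) has_real_derivative - (G' r * (F r - k r * G r) / (G r * G r))) (at r)"
        using D r by simp
      show "- (G' r * (F r - k r * G r) / (G r * G r)) < 0"
        using G_pos[of r] gt[of r] G'_pos[of r] r by simp
    next
      show "isCont (\<lambda>r. F r / G r) b"
        using D[of b] True by (auto intro: DERIV_isCont)
    qed
  next
    case False
    then show ?thesis by (auto intro: monotone_onI)
  qed
qed

section \<open>A single radial profile\<close>

text \<open>\<open>H\<close> is the whole right-hand side along the solution, as a function of r
  alone. This decouples the system, so the same facts serve both components of both systems.\<close>

locale radial_profile =
  fixes n :: nat and p R :: real and w H :: "real \<Rightarrow> real"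
  assumes p: "p > 1" and n: "n \<ge> 2" and R: "R > 0"
    and deriv_0: "(w has_real_derivative 0) (at 0 within {0..<R})"
    and diff: "\<And>r. 0 < r \<Longrightarrow> r < R \<Longrightarrow> w differentiable (at r)"
    and eq: "\<And>r. 0 < r \<Longrightarrow> r < R \<Longrightarrow>
      ((\<lambda>s. s ^ (n - 1) * deriv w s * \<bar>deriv w s\<bar> powr (p - 2)) has_real_derivative
        r ^ (n - 1) * H r) (at r)"
    and H_nonneg: "\<And>r. 0 < r \<Longrightarrow> r < R \<Longrightarrow> H r \<ge> 0"
    and nonconst: "nonconstant_radial R w"
begin

text \<open>The flux of the equation without its sign bookkeeping; both forms agree once the slope
  is known to be positive (\<open>flux_eq\<close>).\<close>

definition flux :: "real \<Rightarrow> real" where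
  "flux r = r ^ (n - 1) * deriv w r powr (p - 1)"

lemma has_deriv: "0 < r \<Longrightarrow> r < R \<Longrightarrow> (w has_real_derivative deriv w r) (at r)"
  using diff DERIV_deriv_iff_real_differentiable by blast

lemma isCont: "0 < r \<Longrightarrow> r < R \<Longrightarrow> isCont w r"
  using has_deriv DERIV_isCont by blast

lemma continuous: "continuous_on {0..<R} w"
  unfolding continuous_on_eq_continuous_within
proof
  fix x assume "x \<in> {0..<R}"
  then show "continuous (at x within {0..<R}) w"
    using DERIV_continuous[OF deriv_0] isCont[of x]
    by (cases "x = 0") (auto intro: continuous_at_imp_continuous_within)
qed

lemma tendsto_center: "(w \<longlongrightarrow> w 0) (at_right 0)"
proof -
  have "(w \<longlongrightarrow> w 0) (at 0 within {0..<R})"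
    using DERIV_continuous[OF deriv_0] by (simp add: continuous_within)
  then have "(w \<longlongrightarrow> w 0) (at 0 within {0<..<R})"
    by (rule tendsto_within_subset) auto
  moreover have "at 0 within {0<..<R} = at_right (0::real)"
    using R by (intro at_within_nhd[of _ "{-R<..<R}"]) auto
  ultimately show ?thesis by simp
qed

text \<open>The mean value theorem turns the small difference quotient at 0 into a point of small
  slope. Such points replace continuity of the slope at 0, which is not part of the notion of
  solution.\<close>

lemma small_slope:
  assumes "\<delta> > 0" "\<epsilon> > 0"
  obtains s where "0 < s" "s < \<delta>" "s < R" "\<bar>deriv w s\<bar> < \<epsilon>"
proof -
  have "((\<lambda>r. (w r - w 0) / (r - 0)) \<longlongrightarrow> 0) (at 0 within {0..<R})"
    using deriv_0 by (simp add: has_field_derivative_iff)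
  then have "\<forall>\<^sub>F r in at 0 within {0..<R}. dist ((w r - w 0) / (r - 0)) 0 < \<epsilon>"
    using \<open>\<epsilon> > 0\<close> by (rule tendstoD)
  then obtain d where d: "d > 0"
    "\<And>r. r \<in> {0..<R} \<Longrightarrow> r \<noteq> 0 \<Longrightarrow> dist r 0 < d \<Longrightarrow> dist ((w r - w 0) / (r - 0)) 0 < \<epsilon>"
    unfolding eventually_at by blast
  define r where "r = min (min (d/2) (\<delta>/2)) (R/2)"
  have r: "0 < r" "r < d" "r < \<delta>" "r < R"
    using d R assms unfolding r_def by auto
  have q: "\<bar>(w r - w 0) / r\<bar> < \<epsilon>"
    using d(2)[of r] r by simp
  obtain s where s: "0 < s" "s < r" "w r - w 0 = (r - 0) * deriv w s"
  proof -
    have "\<exists>l z. 0 < z \<and> z < r \<and> (w has_real_derivative l) (at z) \<and> w r - w 0 = (r - 0) * l"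
      using r diff by (intro MVT continuous_on_subset[OF continuous]) auto
    then show ?thesis using that DERIV_imp_deriv by blast
  qed
  then have "\<bar>deriv w s\<bar> < \<epsilon>" using q r by simp
  then show ?thesis using that s r by simp
qed

lemma flux_mono:
  assumes "0 < s" "s \<le> a" "a < R"
  shows "s ^ (n - 1) * deriv w s * \<bar>deriv w s\<bar> powr (p - 2)
    \<le> a ^ (n - 1) * deriv w a * \<bar>deriv w a\<bar> powr (p - 2)"
proof (rule DERIV_nonneg_imp_nondecreasing[OF \<open>s \<le> a\<close>])
  fix x assume "s \<le> x" "x \<le> a"
  then have x: "0 < x" "x < R" using assms by auto
  then have "0 \<le> x ^ (n - 1) * H x" using H_nonneg[of x] by simp
  then show "\<exists>y. ((\<lambda>s. s ^ (n - 1) * deriv w s * \<bar>deriv w s\<bar> powr (p - 2))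
      has_real_derivative y) (at x) \<and> 0 \<le> y"
    using eq[OF x] by blast
qed

text \<open>The flux is nondecreasing, so a negative slope at a would force slopes at least as
  negative at all s < a, against \<open>small_slope\<close>.\<close>

lemma deriv_nonneg:
  assumes "0 < a" "a < R"
  shows "deriv w a \<ge> 0"
proof (rule ccontr)
  assume "\<not> deriv w a \<ge> 0"
  then have a: "deriv w a < 0" by simp
  define \<phi> where "\<phi> t = t * \<bar>t\<bar> powr (p - 2)" for t :: real
  have neg: "\<phi> t = - ((-t) powr (p - 1))" if "t < 0" for t
    using powr_mult_base[of "-t" "p - 2"] that by (simp add: \<phi>_def)
  obtain s where s: "0 < s" "s < a" "\<bar>deriv w s\<bar> < - deriv w a"
    using small_slope[of a "- deriv w a"] assms a by auto
  have "s ^ (n - 1) * \<phi> (deriv w s) \<le> a ^ (n - 1) * \<phi> (deriv w a)"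
    using flux_mono[of s a] s assms by (simp add: \<phi>_def mult.assoc)
  \<comment> \<open>\<open>\<phi> (deriv w a)\<close> is negative, so the smaller weight at s gives
    the larger product.\<close>
  also have "\<dots> \<le> s ^ (n - 1) * \<phi> (deriv w a)"
    using s a neg[OF a] by (intro mult_right_mono_neg power_mono) auto
  finally have "\<phi> (deriv w s) \<le> \<phi> (deriv w a)"
    using s by simp
  moreover have "\<phi> (deriv w s) > \<phi> (deriv w a)"
  proof (cases "deriv w s < 0")
    case True
    then show ?thesis using s neg[OF a] neg[OF True] p
      by (simp add: powr_less_mono2)
  next
    case False
    then have "\<phi> (deriv w s) \<ge> 0" by (simp add: \<phi>_def)
    moreover have "\<phi> (deriv w a) < 0" using neg[OF a] a by simp
    ultimately show ?thesis by linarith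
  qed
  ultimately show False by simp
qed

text \<open>A zero slope at a makes the nonnegative, nondecreasing flux vanish on
  \<open>(0,a)\<close>, so w is constant near the centre. Here \<open>nonconst\<close> rules out
  dead cores.\<close>

lemma deriv_pos:
  assumes "0 < a" "a < R"
  shows "deriv w a > 0"
proof (rule ccontr)
  assume "\<not> deriv w a > 0"
  then have a: "deriv w a = 0" using deriv_nonneg[OF assms] by simp
  have zero: "deriv w s = 0" if s: "0 < s" "s < a" for s
  proof (rule ccontr)
    assume "deriv w s \<noteq> 0"
    then have "deriv w s > 0" using deriv_nonneg[of s] s assms by force
    then have "s ^ (n - 1) * deriv w s * \<bar>deriv w s\<bar> powr (p - 2) > 0" using s by simp
    then show False using flux_mono[of s a] s assms a by simp
  qed
  have "w s = w 0" if "s \<in> {0..<a}" for s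
  proof (cases "s = 0")
    case False
    then have "s > 0" using that by simp
    then show ?thesis
    proof (rule DERIV_isconst_end)
      show "continuous_on {0..s} w"
        using that assms by (intro continuous_on_subset[OF continuous]) auto
      show "(w has_real_derivative 0) (at x)" if "0 < x" "x < s" for x
        using has_deriv[of x] zero[of x] that \<open>s \<in> {0..<a}\<close> assms by simp
    qed
  qed simp
  then have "w constant_on {0..<a}" unfolding constant_on_def by blast
  then show False using nonconst assms unfolding nonconstant_radial_def by auto
qed

lemma strict_mono:
  assumes "0 \<le> x" "x < y" "y < R"
  shows "w x < w y"
proof (rule DERIV_pos_imp_increasing_open[OF \<open>x < y\<close>])
  show "\<exists>l. (w has_real_derivative l) (at t) \<and> 0 < l" if "x < t" "t < y" for t
    using has_deriv[of t] deriv_pos[of t] that assms by auto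
  show "continuous_on {x..y} w"
    using assms by (intro continuous_on_subset[OF continuous]) auto
qed

lemma flux_pos: "0 < r \<Longrightarrow> r < R \<Longrightarrow> flux r > 0"
  using deriv_pos[of r] unfolding flux_def by (intro mult_pos_pos) auto

lemma flux_eq:
  assumes "0 < r" "r < R"
  shows "r ^ (n - 1) * deriv w r * \<bar>deriv w r\<bar> powr (p - 2) = flux r"
  using powr_mult_base[of "deriv w r" "p - 2"] deriv_pos[OF assms]
  by (simp add: flux_def mult.assoc)

lemma has_deriv_flux:
  assumes "0 < r" "r < R"
  shows "(flux has_real_derivative r ^ (n - 1) * H r) (at r)"
  by (rule DERIV_cong_ev[OF refl _ refl, THEN iffD1, OF _ eq[OF assms]])
     (use assms flux_eq in \<open>auto simp: eventually_nhds intro!: exI[of _ "{0<..<R}"]\<close>)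

text \<open>The flux at one point bounds the flux at all smaller radii, and it is small at a point
  below 1 with small slope.\<close>

lemma flux_tendsto_0: "(flux \<longlongrightarrow> 0) (at_right 0)"
proof (rule tendstoI)
  fix \<epsilon> :: real assume "\<epsilon> > 0"
  obtain s where s: "0 < s" "s < min 1 R" "\<bar>deriv w s\<bar> < \<epsilon> powr (1 / (p - 1))"
    using small_slope[of "min 1 R" "\<epsilon> powr (1 / (p - 1))"] R \<open>\<epsilon> > 0\<close> by auto
  have "flux s \<le> 1 * deriv w s powr (p - 1)"
    unfolding flux_def using s by (intro mult_right_mono power_le_one) auto
  also have "\<dots> < (\<epsilon> powr (1 / (p - 1))) powr (p - 1)"
    using s p deriv_pos[of s] by (simp add: powr_less_mono2)
  also have "\<dots> = \<epsilon>" using p \<open>\<epsilon> > 0\<close> by (simp add: powr_powr)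
  finally have fs: "flux s < \<epsilon>" .
  have "dist (flux r) 0 < \<epsilon>" if "0 < r" "r < s" for r
    using flux_mono[of r s] flux_eq[of r] flux_eq[of s] flux_pos[of r] fs that s by simp
  then show "\<forall>\<^sub>F r in at_right 0. dist (flux r) 0 < \<epsilon>"
    unfolding eventually_at_right_field using s by blast
qed

text \<open>Obtained by dividing the flux by its weight. The resulting term with
  \<open>(n - 1)\<close> has a favourable sign and is dropped in the growth estimates.\<close>

lemma has_deriv_slope_powr:
  assumes "0 < r" "r < R"
  shows "((\<lambda>s. deriv w s powr (p - 1)) has_real_derivative
    H r - (n - 1) * deriv w r powr (p - 1) / r) (at r)"
proof -
  have "((\<lambda>s. flux s / s ^ (n - 1)) has_real_derivative
     H r - (n - 1) * deriv w r powr (p - 1) / r) (at r)"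
  proof -
    have r: "r ^ (n - 1) = r * r ^ (n - 2)"
      using n by (metis Suc_1 Suc_diff_Suc Suc_le_lessD diff_Suc_1' power_Suc One_nat_def)
    have "((\<lambda>s. flux s / s ^ (n - 1)) has_real_derivative
       (r ^ (n - 1) * H r * r ^ (n - 1) - flux r * (real (n - 1) * r ^ (n - 2)))
         / (r ^ (n - 1) * r ^ (n - 1))) (at r)"
      using assms by (intro DERIV_divide has_deriv_flux)
        (auto intro!: derivative_eq_intros simp: numeral_2_eq_2)
    also have "(r ^ (n - 1) * H r * r ^ (n - 1) - flux r * (real (n - 1) * r ^ (n - 2)))
         / (r ^ (n - 1) * r ^ (n - 1)) = H r - (n - 1) * deriv w r powr (p - 1) / r"
      unfolding flux_def r using assms by (simp add: field_simps)
    finally show ?thesis .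
  qed
  then show ?thesis
    by (rule DERIV_cong_ev[OF refl _ refl, THEN iffD1, rotated])
       (use assms in \<open>auto simp: flux_def eventually_nhds intro!: exI[of _ "{0<..<R}"]\<close>)
qed

text \<open>The slope is the root of order \<open>p - 1\<close> of a function just shown to be
  differentiable.\<close>

lemma isCont_deriv:
  assumes "0 < r" "r < R"
  shows "isCont (deriv w) r"
proof -
  have "isCont (\<lambda>s. (deriv w s powr (p - 1)) powr (1 / (p - 1))) r"
    using tendsto_powr[OF DERIV_isCont[OF has_deriv_slope_powr[OF assms], unfolded isCont_def]
        tendsto_const, of "1 / (p - 1)"] deriv_pos[OF assms]
    by (simp add: isCont_def del: powr_powr)
  moreover have "\<forall>\<^sub>F s in nhds r. (deriv w s powr (p - 1)) powr (1 / (p - 1)) = deriv w s"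
    using assms p deriv_pos
    by (auto simp: eventually_nhds powr_powr less_imp_le intro!: exI[of _ "{0<..<R}"])
  ultimately show ?thesis using isCont_cong by force
qed

text \<open>Gronwall argument for \<open>y\<close>: since its derivative is at most
  \<open>C * (1 + y)\<close>, the product \<open>(1 + y) * exp (- C * r)\<close> is nonincreasing.
  Starting from points of small slope gives \<open>y b \<le> exp (C * b) - 1\<close>.\<close>

lemma deriv_tendsto_0:
  assumes "C \<ge> 0" "d > 0" "d \<le> R"
    and growth: "\<And>r. 0 < r \<Longrightarrow> r < d \<Longrightarrow> H r \<le> C * (1 + deriv w r powr (p - 1))"
  shows "(deriv w \<longlongrightarrow> 0) (at_right 0)"
proof -
  define y where "y r = deriv w r powr (p - 1)" for r
  have y_nonneg: "y r \<ge> 0" for r by (simp add: y_def)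
  have step: "(1 + y b) * exp (- C * b) \<le> (1 + y a) * exp (- C * a)"
    if "0 < a" "a \<le> b" "b < d" for a b
  proof (rule DERIV_nonpos_imp_nonincreasing[OF \<open>a \<le> b\<close>])
    fix r assume "a \<le> r" "r \<le> b"
    then have r: "0 < r" "r < d" "r < R" using that assms by auto
    have D: "((\<lambda>r. (1 + y r) * exp (- C * r)) has_real_derivative
      (H r - (n - 1) * y r / r - C * (1 + y r)) * exp (- C * r)) (at r)"
      unfolding y_def
      by (rule derivative_eq_intros has_deriv_slope_powr refl r)+ (simp add: algebra_simps)
    have "(n - 1) * y r / r \<ge> 0" using r y_nonneg by simp
    then have "(H r - (n - 1) * y r / r - C * (1 + y r)) * exp (- C * r) \<le> 0"
      using growth[OF r(1,2)] by (intro mult_nonpos_nonneg) (auto simp: y_def)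
    with D show "\<exists>l. ((\<lambda>r. (1 + y r) * exp (- C * r)) has_real_derivative l) (at r) \<and> l \<le> 0"
      by blast
  qed
  have bound: "1 + y b \<le> exp (C * b)" if b: "0 < b" "b < d" for b
  proof (rule field_le_epsilon)
    fix e :: real assume "e > 0"
    \<comment> \<open>Chosen so that a slope below \<epsilon> at a gives
      \<open>y a * exp (C * b) \<le> e\<close>.\<close>
    define \<epsilon> where "\<epsilon> = (e / exp (C * b)) powr (1 / (p - 1))"
    have "\<epsilon> > 0" using \<open>e > 0\<close> by (simp add: \<epsilon>_def)
    then obtain a where a: "0 < a" "a < b" "\<bar>deriv w a\<bar> < \<epsilon>"
      using small_slope[of b \<epsilon>] b by auto
    have "y a \<le> \<epsilon> powr (p - 1)"
      unfolding y_def using a b p assms deriv_pos[of a] by (intro powr_mono2) auto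
    also have "\<dots> = e / exp (C * b)" using \<open>e > 0\<close> p by (simp add: \<epsilon>_def powr_powr)
    finally have ya: "y a * exp (C * b) \<le> e" by (simp add: field_simps)
    have "(1 + y b) * exp (- C * b) \<le> (1 + y a) * exp (- C * a)"
      using step[of a b] a b by simp
    also have "\<dots> \<le> (1 + y a) * 1"
      using a assms y_nonneg by (intro mult_left_mono) (auto simp: add_nonneg_nonneg)
    finally have "1 + y b \<le> (1 + y a) * exp (C * b)"
      by (simp add: exp_minus field_simps)
    also have "\<dots> \<le> exp (C * b) + e" using ya by (simp add: algebra_simps)
    finally show "1 + y b \<le> exp (C * b) + e" .
  qed
  have "(y \<longlongrightarrow> 0) (at_right 0)"
  proof (rule tendsto_sandwich[of "\<lambda>_. 0" y _ "\<lambda>b. exp (C * b) - 1"])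
    show "\<forall>\<^sub>F b in at_right 0. y b \<le> exp (C * b) - 1"
      unfolding eventually_at_right_field using bound assms by (intro exI[of _ d]) force
    have "((\<lambda>b. exp (C * b) - 1) \<longlongrightarrow> exp (C * 0) - 1) (at_right 0)"
      by (intro tendsto_intros)
    then show "((\<lambda>b. exp (C * b) - 1) \<longlongrightarrow> 0) (at_right 0)" by simp
  qed (use y_nonneg in auto)
  then have "((\<lambda>r. y r powr (1 / (p - 1))) \<longlongrightarrow> 0 powr (1 / (p - 1))) (at_right 0)"
    using p y_nonneg by (intro tendsto_powr') auto
  moreover have "\<forall>\<^sub>F r in at_right 0. y r powr (1 / (p - 1)) = deriv w r"
    unfolding eventually_at_right_field using R p deriv_pos
    by (intro exI[of _ R]) (auto simp: y_def powr_powr less_imp_le)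
  ultimately show ?thesis by (auto dest: tendsto_cong)
qed

text \<open>A gradient term of degree at least \<open>p - 1\<close> prevents the slope from leaving zero at the
  centre, by comparison with \<open>y' = C y powr (\<alpha> / (p - 1))\<close>, which has no solution issuing from zero.\<close>

lemma gradient_exponent_less:
  assumes "C \<ge> 0" "d > 0" "d \<le> R"
    and growth: "\<And>r. 0 < r \<Longrightarrow> r < d \<Longrightarrow> H r \<le> C * deriv w r powr \<alpha>"
  shows "\<alpha> < p - 1"
proof (rule ccontr)
  assume "\<not> \<alpha> < p - 1"
  define y where "y r = deriv w r powr (p - 1)" for r
  have y_pos: "y r > 0" if "0 < r" "r < R" for r using deriv_pos[OF that] by (simp add: y_def)
  have D: "(y has_real_derivative H r - (n - 1) * y r / r) (at r)" if "0 < r" "r < R" for r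
    using has_deriv_slope_powr[OF that] by (simp add: y_def[abs_def])
  have le: "H r - (n - 1) * y r / r \<le> C * deriv w r powr \<alpha>" if "0 < r" "r < d" for r
  proof -
    have "(n - 1) * y r / r \<ge> 0" using that y_pos[of r] assms by simp
    then show ?thesis using growth[OF that] by simp
  qed
  define b where "b = d / 2"
  have b: "0 < b" "b < d" "b < R" using assms by (auto simp: b_def)
  consider "\<alpha> = p - 1" | "\<alpha> > p - 1" using \<open>\<not> \<alpha> < p - 1\<close> by linarith
  then show False
  proof cases
    case 1
    \<comment> \<open>This bounds \<open>ln (y a)\<close> from below near the centre, whereas points
      of small slope make it arbitrarily negative.\<close>
    have step: "ln (y b) - C * b \<le> ln (y a) - C * a" if "0 < a" "a \<le> b" for a
    proof (rule DERIV_nonpos_imp_nonincreasing[OF \<open>a \<le> b\<close>])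
      fix r assume "a \<le> r" "r \<le> b"
      then have r: "0 < r" "r < d" "r < R" using that b by auto
      have D': "((\<lambda>r. ln (y r) - C * r) has_real_derivative
          (H r - (n - 1) * y r / r) / y r - C) (at r)"
        using r y_pos[of r] by (auto intro!: derivative_eq_intros D)
      have "(H r - (n - 1) * y r / r) / y r - C \<le> 0"
        using le[of r] r y_pos[of r] 1 by (simp add: y_def divide_simps mult_ac)
      with D' show "\<exists>l. ((\<lambda>r. ln (y r) - C * r) has_real_derivative l) (at r) \<and> l \<le> 0" by blast
    qed
    define \<epsilon> where "\<epsilon> = exp ((ln (y b) - C * b) / (p - 1))"
    obtain a where a: "0 < a" "a < b" "\<bar>deriv w a\<bar> < \<epsilon>"
      using small_slope[of b \<epsilon>] b by (auto simp: \<epsilon>_def)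
    have "deriv w a > 0" using a b deriv_pos by simp
    then have "ln (deriv w a) < ln \<epsilon>"
      using a by (subst ln_less_cancel_iff) auto
    then have "(p - 1) * ln (deriv w a) < (p - 1) * ln \<epsilon>"
      using p by simp
    also have "\<dots> = ln (y b) - C * b" using p by (simp add: \<epsilon>_def)
    finally have "ln (y a) < ln (y b) - C * b"
      using \<open>deriv w a > 0\<close> by (simp add: y_def ln_powr)
    moreover have "C * a \<ge> 0" using a assms by simp
    ultimately show False using step[of a] a by simp
  next
    case 2
    \<comment> \<open>The excess over 1 of the exponent of y. By \<open>step\<close>,
      \<open>y powr (- e)\<close> stays bounded near the centre, although y is arbitrarily small
      there.\<close>
    define e where "e = \<alpha> / (p - 1) - 1"
    have e: "e > 0" using 2 p by (simp add: e_def field_simps)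
    have step: "y a powr (- e) + e * C * a \<le> y b powr (- e) + e * C * b" if "0 < a" "a \<le> b" for a
    proof (rule DERIV_nonneg_imp_nondecreasing[OF \<open>a \<le> b\<close>])
      fix r assume "a \<le> r" "r \<le> b"
      then have r: "0 < r" "r < d" "r < R" using that b by auto
      have D': "((\<lambda>r. y r powr (- e) + e * C * r) has_real_derivative
          e * (C - y r powr (- e - 1) * (H r - (n - 1) * y r / r))) (at r)"
        using r y_pos[of r] by (auto intro!: derivative_eq_intros D simp: algebra_simps)
      have "deriv w r powr \<alpha> = y r powr (e + 1)"
        using p by (simp add: y_def powr_powr e_def)
      then have "y r powr (- e - 1) * (H r - (n - 1) * y r / r)
          \<le> y r powr (- e - 1) * (C * y r powr (e + 1))"
        using le[of r] r by (intro mult_left_mono) auto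
      also have "\<dots> = C * y r powr (- e - 1 + (e + 1))"
        by (simp only: powr_add mult_ac)
      also have "\<dots> = C" using y_pos[of r] r by simp
      finally have "e * (C - y r powr (- e - 1) * (H r - (n - 1) * y r / r)) \<ge> 0"
        using e by simp
      with D' show "\<exists>l. ((\<lambda>r. y r powr (- e) + e * C * r) has_real_derivative l) (at r) \<and> 0 \<le> l"
        by blast
    qed
    define M where "M = y b powr (- e) + e * C * b"
    have "M > 0" unfolding M_def using y_pos[of b] b e assms by (intro add_pos_nonneg) auto
    \<comment> \<open>Solves \<open>\<epsilon> powr (- e * (p - 1)) = M\<close>, so a slope below
      \<epsilon> pushes \<open>y powr (- e)\<close> above its bound M.\<close>
    define \<epsilon> where "\<epsilon> = M powr (- 1 / (e * (p - 1)))"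
    obtain a where a: "0 < a" "a < b" "\<bar>deriv w a\<bar> < \<epsilon>"
      using small_slope[of b \<epsilon>] b \<open>M > 0\<close> by (auto simp: \<epsilon>_def)
    have "deriv w a > 0" using a b deriv_pos by simp
    have "M = \<epsilon> powr (- e * (p - 1))"
      using \<open>M > 0\<close> e p by (simp add: \<epsilon>_def powr_powr)
    also have "\<dots> < deriv w a powr (- e * (p - 1))"
      using a \<open>deriv w a > 0\<close> e p by (intro powr_less_mono2_neg) (auto simp: mult_neg_pos)
    also have "\<dots> = y a powr (- e)" by (simp add: y_def powr_powr mult.commute)
    finally have "M < y a powr (- e)" .
    moreover have "e * C * a \<ge> 0" using a e assms by simp
    ultimately show False using step[of a] a by (simp add: M_def)
  qed
qed

lemma flux_powr_eq:
  assumes "0 < r" "r < R"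
  shows "flux r powr \<kappa> = r powr (real (n - 1) * \<kappa>) * deriv w r powr ((p - 1) * \<kappa>)"
  using assms deriv_pos[OF assms]
  by (simp add: flux_def powr_mult powr_powr powr_realpow[symmetric])

text \<open>As \<open>(p - 1) * (\<kappa> - 1) = - \<alpha>\<close>, the chain-rule factor
  \<open>flux r powr (\<kappa> - 1)\<close> cancels the gradient term.\<close>

lemma has_deriv_flux_powr:
  assumes r: "0 < r" "r < R" and H: "H r = \<Phi> * deriv w r powr \<alpha>"
    and \<kappa>: "\<kappa> = 1 - \<alpha> / (p - 1)"
  shows "((\<lambda>s. flux s powr \<kappa>) has_real_derivative \<kappa> * (r powr (real (n - 1) * \<kappa>) * \<Phi>)) (at r)"
proof -
  have "((\<lambda>s. flux s powr \<kappa>) has_real_derivative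
      \<kappa> * flux r powr (\<kappa> - 1) * (r ^ (n - 1) * H r)) (at r)"
    using DERIV_fun_powr[OF has_deriv_flux[OF r] flux_pos[OF r], of \<kappa>]
    by (simp add: mult_ac)
  moreover have "flux r powr (\<kappa> - 1) * (r ^ (n - 1) * H r) = r powr (real (n - 1) * \<kappa>) * \<Phi>"
  proof -
    have e: "(p - 1) * (\<kappa> - 1) = - \<alpha>" using p by (simp add: \<kappa>)
    have "flux r powr (\<kappa> - 1) * (r ^ (n - 1) * H r)
       = (r powr (real (n - 1) * (\<kappa> - 1)) * r powr real (n - 1)) *
         (deriv w r powr (- \<alpha>) * deriv w r powr \<alpha>) * \<Phi>"
      using r by (simp add: flux_powr_eq[OF r] e H powr_realpow)
    also have "deriv w r powr (- \<alpha>) * deriv w r powr \<alpha> = 1"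
      using deriv_pos[OF r] by (simp flip: powr_add)
    also have "r powr (real (n - 1) * (\<kappa> - 1)) * r powr real (n - 1) = r powr (real (n - 1) * \<kappa>)"
      by (simp flip: powr_add add: algebra_simps)
    finally show ?thesis by simp
  qed
  ultimately show ?thesis by (simp add: mult.assoc)
qed

lemma flux_powr_tendsto_0:
  assumes "\<kappa> > 0"
  shows "((\<lambda>r. flux r powr \<kappa>) \<longlongrightarrow> 0) (at_right 0)"
proof -
  have "\<forall>\<^sub>F r in at_right 0. flux r \<ge> 0"
    unfolding eventually_at_right_field using R flux_pos by (intro exI[of _ R]) (auto intro: less_imp_le)
  then have "((\<lambda>r. flux r powr \<kappa>) \<longlongrightarrow> 0 powr \<kappa>) (at_right 0)"
    using assms by (intro tendsto_powr' flux_tendsto_0) auto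
  then show ?thesis by simp
qed

end

section \<open>The coupled system near the centre, and monotonicity of the slope of u\<close>

locale radial_system =
  fixes n :: nat and p \<alpha> R :: real and f1 f2 G1 G2 G3 u v :: "real \<Rightarrow> real"
  assumes p: "p > 1" and n: "n \<ge> 2" and \<alpha>: "\<alpha> \<ge> 0" and R: "R > 0"
    and sol: "radial_solution n p \<alpha> R f1 f2 G1 G2 G3 u v"
    and mono_f: "mono_on {0..} f1" "mono_on {0..} f2"
    and mono_G: "mono_on {0..} G1" "mono_on {0..} G2" "mono_on {0..} G3"
    and f_pos: "\<And>t. t > 0 \<Longrightarrow> f1 t > 0" "\<And>t. t > 0 \<Longrightarrow> f2 t > 0"
    and G_pos: "\<And>t. t > 0 \<Longrightarrow> G1 t > 0" "\<And>t. t > 0 \<Longrightarrow> G2 t > 0" "\<And>t. t > 0 \<Longrightarrow> G3 t > 0"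
    and nonconst: "nonconstant_radial R u" "nonconstant_radial R v"
    and v_pos: "\<And>r. 0 < r \<Longrightarrow> r < R \<Longrightarrow> v r > 0"
begin

sublocale u: radial_profile n p R u "\<lambda>r. f1 r * G1 (v r) * abs_pow \<alpha> (deriv u r)"
proof
  show "f1 r * G1 (v r) * abs_pow \<alpha> (deriv u r) \<ge> 0" if "0 < r" "r < R" for r
    using f_pos(1)[of r] G_pos(1)[OF v_pos[of r]] that by (simp add: abs_pow_def)
qed (use p n R sol nonconst in \<open>auto simp: radial_solution_def\<close>)

text \<open>The order matters: \<open>G3\<close> is assumed positive only at positive arguments, so
  the positive slope of u from the first interpretation is used here.\<close>

sublocale v: radial_profile n p R v "\<lambda>r. f2 r * G2 (v r) * G3 \<bar>deriv u r\<bar>"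
proof
  show "f2 r * G2 (v r) * G3 \<bar>deriv u r\<bar> \<ge> 0" if "0 < r" "r < R" for r
    using f_pos(2)[of r] G_pos(2)[OF v_pos[of r]] G_pos(3)[of "deriv u r"] u.deriv_pos[of r] that
    by simp
qed (use p n R sol nonconst in \<open>auto simp: radial_solution_def\<close>)

lemma u_equation:
  "0 < r \<Longrightarrow> r < R \<Longrightarrow>
    f1 r * G1 (v r) * abs_pow \<alpha> (deriv u r) = f1 r * G1 (v r) * deriv u r powr \<alpha>"
  using u.deriv_pos[of r] by (simp add: abs_pow_def)

text \<open>As v increases, the coefficient is largest at \<open>R / 2\<close>. Freezing it there
  leaves a differential inequality for the slope of u alone.\<close>

lemma u_growth:
  assumes "0 < r" "r < R / 2"
  shows "f1 r * G1 (v r) * abs_pow \<alpha> (deriv u r)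
    \<le> f1 (R / 2) * G1 (v (R / 2)) * deriv u r powr \<alpha>"
proof -
  have r: "0 < r" "r < R" using assms by auto
  have "v r \<le> v (R / 2)" using v.strict_mono[of r "R / 2"] assms R by simp
  then have "G1 (v r) \<le> G1 (v (R / 2))"
    using v_pos[OF r] by (intro mono_onD[OF mono_G(1)]) auto
  moreover have "f1 r \<le> f1 (R / 2)" using assms by (intro mono_onD[OF mono_f(1)]) auto
  ultimately show ?thesis
    unfolding u_equation[OF r] using f_pos(1)[of r] f_pos(1)[of "R / 2"] G_pos(1)[OF v_pos[OF r]] R r
    by (intro mult_right_mono mult_mono) auto
qed

lemma bound_nonneg: "f1 (R / 2) * G1 (v (R / 2)) \<ge> 0" "f2 (R / 2) * G2 (v (R / 2)) \<ge> 0"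
  using f_pos[of "R / 2"] G_pos(1,2)[OF v_pos[of "R / 2"]] R by auto

lemma \<alpha>_less: "\<alpha> < p - 1"
  using u.gradient_exponent_less[OF bound_nonneg(1), of "R / 2" \<alpha>] u_growth R by simp

text \<open>With \<open>\<alpha> < p - 1\<close> the gradient term is at most
  \<open>1 + deriv u r powr (p - 1)\<close>, the growth that the Gronwall argument allows.\<close>

lemma deriv_u_tendsto_0: "(deriv u \<longlongrightarrow> 0) (at_right 0)"
proof (rule u.deriv_tendsto_0[OF bound_nonneg(1), of "R / 2"])
  fix r assume r: "0 < r" "r < R / 2"
  let ?C = "f1 (R / 2) * G1 (v (R / 2))"
  have pos: "deriv u r > 0" using u.deriv_pos r by simp
  have "deriv u r powr \<alpha> \<le> 1 + deriv u r powr (p - 1)"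
  proof (cases "deriv u r \<le> 1")
    case True
    then have "deriv u r powr \<alpha> \<le> 1" using \<alpha> pos by (intro powr_le1) auto
    then show ?thesis by (simp add: add_increasing2)
  next
    case False
    then have "deriv u r powr \<alpha> \<le> deriv u r powr (p - 1)" using \<alpha>_less by (intro powr_mono) auto
    then show ?thesis by simp
  qed
  then have "?C * deriv u r powr \<alpha> \<le> ?C * (1 + deriv u r powr (p - 1))"
    by (rule mult_left_mono[OF _ bound_nonneg(1)])
  then show "f1 r * G1 (v r) * abs_pow \<alpha> (deriv u r) \<le> ?C * (1 + deriv u r powr (p - 1))"
    using u_growth[OF r] by linarith
qed (use R in auto)

text \<open>Near the centre the slope of u is below 1, which bounds the right-hand side of the
  second equation by a constant.\<close>

lemma deriv_v_tendsto_0: "(deriv v \<longlongrightarrow> 0) (at_right 0)"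
proof -
  have "\<forall>\<^sub>F r in at_right 0. deriv u r < 1"
    using deriv_u_tendsto_0 by (rule order_tendstoD) simp
  then obtain d where d: "d > 0" "\<And>r. 0 < r \<Longrightarrow> r < d \<Longrightarrow> deriv u r < 1"
    unfolding eventually_at_right_field by blast
  let ?C = "f2 (R / 2) * G2 (v (R / 2)) * G3 1"
  show ?thesis
  proof (rule v.deriv_tendsto_0[of ?C "min d (R / 2)"])
    show C: "?C \<ge> 0" using bound_nonneg(2) G_pos(3)[of 1] by simp
    fix r assume "0 < r" "r < min d (R / 2)"
    then have r: "0 < r" "r < R" "r < R / 2" "r < d" by auto
    have "v r \<le> v (R / 2)" using v.strict_mono[of r "R / 2"] r by simp
    then have "G2 (v r) \<le> G2 (v (R / 2))"
      using v_pos[OF r(1,2)] by (intro mono_onD[OF mono_G(2)]) auto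
    moreover have "f2 r \<le> f2 (R / 2)" using r by (intro mono_onD[OF mono_f(2)]) auto
    moreover have "G3 \<bar>deriv u r\<bar> \<le> G3 1"
      using d(2)[OF r(1,4)] u.deriv_pos[OF r(1,2)] by (intro mono_onD[OF mono_G(3)]) auto
    ultimately have "f2 r * G2 (v r) * G3 \<bar>deriv u r\<bar> \<le> ?C"
      using f_pos(2)[of r] f_pos(2)[of "R / 2"] G_pos(2)[OF v_pos[OF r(1,2)]]
        G_pos(3)[of "\<bar>deriv u r\<bar>"] u.deriv_pos[OF r(1,2)] bound_nonneg(2) r
      by (intro mult_mono) auto
    also have "\<dots> \<le> ?C * (1 + deriv v r powr (p - 1))"
      using mult_left_mono[OF _ C, of 1 "1 + deriv v r powr (p - 1)"] by simp
    finally show "f2 r * G2 (v r) * G3 \<bar>deriv u r\<bar> \<le> ?C * (1 + deriv v r powr (p - 1))" .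
  qed (use d R in auto)
qed

lemma has_deriv_u_flux_powr:
  assumes "0 < r" "r < R"
  shows "((\<lambda>s. u.flux s powr (1 - \<alpha> / (p - 1))) has_real_derivative
    (1 - \<alpha> / (p - 1)) * (r powr (real (n - 1) * (1 - \<alpha> / (p - 1))) * (f1 r * G1 (v r)))) (at r)"
  using u.has_deriv_flux_powr[OF assms u_equation[OF assms]] by simp

lemma exponent_pos: "1 - \<alpha> / (p - 1) > 0"
  using \<alpha>_less p by simp

text \<open>Compares a power of the flux with \<open>r powr m\<close>: their quotient is a power of
  the slope, and the quotient of their derivatives is \<open>k\<close>, strictly increasing thanks
  to its factor r.\<close>

lemma deriv_u_strict_mono:
  assumes "0 < a" "a < b" "b < R"
  shows "deriv u a < deriv u b"
proof -
  define \<kappa> where "\<kappa> = 1 - \<alpha> / (p - 1)"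
  define m where "m = real (n - 1) * \<kappa>"
  define k where "k r = r * (f1 r * G1 (v r)) / real (n - 1)" for r
  have \<kappa>: "\<kappa> > 0" using exponent_pos by (simp add: \<kappa>_def)
  have m: "m > 0" using \<kappa> n by (simp add: m_def)
  \<comment> \<open>The minus signs adapt an increasing quotient to
    \<open>monotone_lhopital\<close>.\<close>
  have anti: "strict_antimono_on {0<..b} (\<lambda>r. - (u.flux r powr \<kappa>) / r powr m)"
  proof (rule monotone_lhopital(1)[where k = "\<lambda>r. - k r" and G' = "\<lambda>r. m * r powr (m - 1)"])
    show "((\<lambda>r. - (u.flux r powr \<kappa>)) \<longlongrightarrow> 0) (at_right 0)"
      using tendsto_minus[OF u.flux_powr_tendsto_0[OF \<kappa>]] by simp
    have "((\<lambda>r. r powr m) \<longlongrightarrow> 0 powr m) (at_right (0::real))"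
      using m by (intro tendsto_powr') (auto simp: eventually_at_right_field intro: exI[of _ 1])
    then show "((\<lambda>r. r powr m) \<longlongrightarrow> 0) (at_right (0::real))" by simp
    fix r assume r: "0 < r" "r \<le> b"
    show "((\<lambda>r. r powr m) has_real_derivative m * r powr (m - 1)) (at r)"
      using has_real_derivative_powr[OF r(1)] .
    show "m * r powr (m - 1) > 0" using m r by simp
    have "r powr m = r * r powr (m - 1)" using powr_mult_base[of r "m - 1"] r by simp
    then have "- (\<kappa> * (r powr m * (f1 r * G1 (v r)))) = - k r * (m * r powr (m - 1))"
      using n by (simp add: k_def m_def)
    then show "((\<lambda>r. - (u.flux r powr \<kappa>)) has_real_derivative - k r * (m * r powr (m - 1))) (at r)"
      using DERIV_minus[OF has_deriv_u_flux_powr[of r, folded \<kappa>_def, folded m_def]] r assms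
      by (simp only:)
  next
    show "strict_antimono_on {0<..b} (\<lambda>r. - k r)"
    proof (rule monotone_onI)
      fix r s assume "r \<in> {0<..b}" "s \<in> {0<..b}" "r < s"
      then have rs: "0 < r" "r < s" "s < R" "r < R" using assms by auto
      have "f1 r \<le> f1 s" using rs by (intro mono_onD[OF mono_f(1)]) auto
      moreover have "G1 (v r) \<le> G1 (v s)"
        using v.strict_mono[of r s] v_pos[of r] rs by (intro mono_onD[OF mono_G(1)]) auto
      ultimately have "r * (f1 r * G1 (v r)) < s * (f1 s * G1 (v s))"
        using rs f_pos(1)[of r] G_pos(1)[OF v_pos[of r]] f_pos(1)[of s] G_pos(1)[OF v_pos[of s]]
        by (intro mult_strict_mono' mult_mono mult_less_le_imp_less) auto
      then show "- k r > - k s" using n by (simp add: k_def divide_strict_right_mono)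
    qed
  qed
  have "- (u.flux a powr \<kappa>) / a powr m > - (u.flux b powr \<kappa>) / b powr m"
    using monotone_onD[OF anti, of a b] assms by simp
  then have less: "deriv u a powr ((p - 1) * \<kappa>) < deriv u b powr ((p - 1) * \<kappa>)"
    using assms u.flux_powr_eq[of a \<kappa>] u.flux_powr_eq[of b \<kappa>] by (simp add: m_def)
  show ?thesis
  proof (rule ccontr)
    assume "\<not> deriv u a < deriv u b"
    then have "deriv u b powr ((p - 1) * \<kappa>) \<le> deriv u a powr ((p - 1) * \<kappa>)"
      using u.deriv_pos[of b] assms p \<kappa> by (intro powr_mono2) auto
    with less show False by simp
  qed
qed

end

section \<open>Quotients of the nonlinearities along two profiles\<close>

text \<open>Freeze the ratio Q at the left point r. Then \<open>y s \<le> Q * z s\<close>, so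
  monotonicity of g reduces the claim to \<open>B3\<close> with factor Q, as t moves from
  \<open>z r\<close> to \<open>z s\<close>.\<close>

lemma quotient_antimono:
  fixes g h y z :: "real \<Rightarrow> real"
  assumes B3: "\<And>s. s \<ge> 1 \<Longrightarrow> antimono_on {0<..} (\<lambda>t. g (s * t) / h t)"
    and g: "mono_on {0..} g" and h: "\<And>t. t > 0 \<Longrightarrow> h t > 0"
    and z: "\<And>r. r \<in> I \<Longrightarrow> z r > 0" "mono_on I z"
    and q: "\<And>r. r \<in> I \<Longrightarrow> y r / z r \<ge> 1" "antimono_on I (\<lambda>r. y r / z r)"
  shows "antimono_on I (\<lambda>r. g (y r) / h (z r))"
proof (rule monotone_onI)
  fix r s assume rs: "r \<in> I" "s \<in> I" "r \<le> s"
  define Q where "Q = y r / z r"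
  have "y s / z s \<le> Q" using monotone_onD[OF q(2) rs] by (simp add: Q_def)
  moreover have "y s > 0" using q(1)[OF rs(2)] z(1)[OF rs(2)] by (simp add: field_simps)
  ultimately have "g (y s) \<le> g (Q * z s)"
    using z(1)[OF rs(2)] by (intro mono_onD[OF g]) (auto simp: field_simps)
  then have "g (y s) / h (z s) \<le> g (Q * z s) / h (z s)"
    using h[OF z(1)[OF rs(2)]] by (simp add: divide_right_mono)
  also have "\<dots> \<le> g (Q * z r) / h (z r)"
    using monotone_onD[OF B3[of Q], of "z r" "z s"] q(1)[OF rs(1)] z(1) rs monotone_onD[OF z(2) rs]
    by (simp add: Q_def)
  also have "Q * z r = y r" using z(1)[OF rs(1)] by (simp add: Q_def)
  finally show "g (y r) / h (z r) \<ge> g (y s) / h (z s)" .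
qed

text \<open>The same argument; strictness comes from \<open>y s < Q * z s\<close> and strict
  monotonicity of g, as \<open>B3\<close> is a weak inequality.\<close>

lemma quotient_strict_antimono:
  fixes g h y z :: "real \<Rightarrow> real"
  assumes B3: "\<And>s. s \<ge> 1 \<Longrightarrow> antimono_on {0<..} (\<lambda>t. g (s * t) / h t)"
    and g: "strict_mono_on {0<..} g" and h: "\<And>t. t > 0 \<Longrightarrow> h t > 0"
    and z: "\<And>r. r \<in> I \<Longrightarrow> z r > 0" "mono_on I z"
    and q: "\<And>r. r \<in> I \<Longrightarrow> y r / z r \<ge> 1" "strict_antimono_on I (\<lambda>r. y r / z r)"
  shows "strict_antimono_on I (\<lambda>r. g (y r) / h (z r))"
proof (rule monotone_onI)
  fix r s assume rs: "r \<in> I" "s \<in> I" "r < s"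
  define Q where "Q = y r / z r"
  have "y s / z s < Q" using monotone_onD[OF q(2) rs] by (simp add: Q_def)
  moreover have "y s > 0" using q(1)[OF rs(2)] z(1)[OF rs(2)] by (simp add: field_simps)
  ultimately have less: "y s < Q * z s" "0 < y s"
    using z(1)[OF rs(2)] by (auto simp: field_simps)
  then have "g (y s) < g (Q * z s)"
    by (intro strict_mono_onD[OF g]) auto
  then have "g (y s) / h (z s) < g (Q * z s) / h (z s)"
    using h[OF z(1)[OF rs(2)]] by (simp add: divide_strict_right_mono)
  also have "\<dots> \<le> g (Q * z r) / h (z r)"
    using monotone_onD[OF B3[of Q], of "z r" "z s"] q(1)[OF rs(1)] z(1) rs monotone_onD[OF z(2), of r s]
    by (simp add: Q_def)
  also have "Q * z r = y r" using z(1)[OF rs(1)] by (simp add: Q_def)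
  finally show "g (y r) / h (z r) > g (y s) / h (z s)" .
qed

lemma quotient_ge_1:
  fixes g h :: "real \<Rightarrow> real"
  assumes g: "mono_on {0..} g" and h: "\<And>t. t > 0 \<Longrightarrow> h t > 0" and le: "\<And>t. t > 0 \<Longrightarrow> g t \<ge> h t"
    and "z > 0" "y / z \<ge> 1"
  shows "g y / h z \<ge> 1"
proof -
  have "z \<le> y" using assms(4,5) by (simp add: field_simps)
  then have "g z \<le> g y" using \<open>z > 0\<close> by (intro mono_onD[OF g]) auto
  then show ?thesis using h[OF \<open>z > 0\<close>] le[OF \<open>z > 0\<close>] by (simp add: field_simps)
qed

lemma strict_antimono_on_powr_cancel:
  fixes w :: "real \<Rightarrow> real"
  assumes "strict_antimono_on I (\<lambda>r. w r powr q)" "q > 0" "\<And>r. r \<in> I \<Longrightarrow> w r \<ge> 0"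
  shows "strict_antimono_on I w"
proof (rule monotone_onI)
  fix r s assume rs: "r \<in> I" "s \<in> I" "r < s"
  then have "w s powr q < w r powr q" using monotone_onD[OF assms(1) rs] by simp
  then show "w r > w s"
    using powr_mono2[of q "w r" "w s"] assms rs by force
qed


section \<open>Comparison of a profile with one that vanishes at the centre\<close>

locale profile_pair =
  x: radial_profile n p R x H + x0: radial_profile n p R x0 H0
  for n p R x H x0 H0 +
  assumes x_0: "x 0 > 0" and x0_0: "x0 0 = 0"
begin

lemma x0_pos: "0 < r \<Longrightarrow> r < R \<Longrightarrow> x0 r > 0"
  using x0.strict_mono[of 0 r] x0_0 by simp

text \<open>Factored so that the derivative is visibly negative exactly where the slope quotient
  lies below the quotient.\<close>

lemma has_deriv_quotient:
  assumes "0 < r" "r < R"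
  shows "((\<lambda>r. x r / x0 r) has_real_derivative
    deriv x0 r / x0 r * (deriv x r / deriv x0 r - x r / x0 r)) (at r)"
  using x0_pos[OF assms] x0.deriv_pos[OF assms]
  by (auto intro!: derivative_eq_intros x.has_deriv x0.has_deriv assms simp: field_simps)

lemma isCont_slope_quotient:
  "0 < r \<Longrightarrow> r < R \<Longrightarrow> isCont (\<lambda>r. deriv x r / deriv x0 r) r"
  using x.isCont_deriv x0.isCont_deriv x0.deriv_pos[of r] by (intro isCont_divide) auto

text \<open>The tangent comparison: \<open>x - (deriv x b / deriv x0 b) x0\<close> is increasing on \<open>[0, b]\<close>
  and starts from the positive value \<open>x 0\<close>.\<close>

lemma slope_quotient_less:
  assumes b: "0 < b" "b < R"
    and anti: "strict_antimono_on {0<..b} (\<lambda>r. deriv x r / deriv x0 r)"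
  shows "deriv x b / deriv x0 b < x b / x0 b"
proof -
  define c where "c = deriv x b / deriv x0 b"
  have D: "((\<lambda>s. x s - c * x0 s) has_real_derivative deriv x s - c * deriv x0 s) (at s)"
    if "0 < s" "s < R" for s
    using that by (auto intro!: derivative_eq_intros x.has_deriv x0.has_deriv)
  have "x 0 - c * x0 0 < x b - c * x0 b"
  proof (rule tendsto_less_if_deriv_pos[OF _ b(1)])
    show "((\<lambda>s. x s - c * x0 s) \<longlongrightarrow> x 0 - c * x0 0) (at_right 0)"
      by (intro tendsto_intros x.tendsto_center x0.tendsto_center)
    show "isCont (\<lambda>s. x s - c * x0 s) b" using D[OF b] by (rule DERIV_isCont)
    fix s assume s: "0 < s" "s < b"
    then show "((\<lambda>s. x s - c * x0 s) has_real_derivative deriv x s - c * deriv x0 s) (at s)"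
      using D b by simp
    have "c < deriv x s / deriv x0 s"
      using monotone_onD[OF anti, of s b] s b by (simp add: c_def)
    then show "deriv x s - c * deriv x0 s > 0"
      using x0.deriv_pos[of s] s b by (simp add: field_simps)
  qed
  then show ?thesis
    using x_0 x0_0 x0_pos[OF b] by (simp add: c_def field_simps)
qed

text \<open>The slope comparison is asked for on the open interval only; continuity adds the
  endpoint b. The continuation argument uses this before the comparison at b is known.\<close>

lemma quotient_strict_antimono_on:
  assumes "b < R"
    and less: "\<And>r. 0 < r \<Longrightarrow> r < b \<Longrightarrow> deriv x r / deriv x0 r < x r / x0 r"
  shows "strict_antimono_on {0<..b} (\<lambda>r. x r / x0 r)"
proof (cases "0 < b")
  case True
  show ?thesis
  proof (rule strict_antimono_on_if_deriv_neg)
    show "isCont (\<lambda>r. x r / x0 r) b"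
      using has_deriv_quotient[OF True \<open>b < R\<close>] by (rule DERIV_isCont)
    fix r assume r: "0 < r" "r < b"
    then show "((\<lambda>r. x r / x0 r) has_real_derivative
        deriv x0 r / x0 r * (deriv x r / deriv x0 r - x r / x0 r)) (at r)"
      using has_deriv_quotient \<open>b < R\<close> by simp
    show "deriv x0 r / x0 r * (deriv x r / deriv x0 r - x r / x0 r) < 0"
      using less[OF r] x0.deriv_pos[of r] x0_pos[of r] r \<open>b < R\<close> by (intro mult_pos_neg) auto
  qed
qed (auto intro: monotone_onI)

text \<open>Multiplied by x0, the first inequality says
  \<open>x r - deriv x r * (x0 r / deriv x0 r) > 0\<close>. The left side tends to
  \<open>x 0\<close>, because the slope tends to 0 and the other factor has a finite limit.\<close>

lemma eventually_quotient_gt: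
  assumes lim: "((\<lambda>r. x0 r / deriv x0 r) \<longlongrightarrow> L) (at_right 0)"
    and slope: "(deriv x \<longlongrightarrow> 0) (at_right 0)"
  shows "\<forall>\<^sub>F r in at_right 0. deriv x r / deriv x0 r < x r / x0 r \<and> 1 < x r / x0 r"
proof -
  have "((\<lambda>r. x r - deriv x r * (x0 r / deriv x0 r)) \<longlongrightarrow> x 0 - 0 * L) (at_right 0)"
    by (intro tendsto_intros x.tendsto_center slope lim)
  then have "\<forall>\<^sub>F r in at_right 0. 0 < x r - deriv x r * (x0 r / deriv x0 r)"
    by (rule order_tendstoD) (use x_0 in simp)
  moreover have "((\<lambda>r. x r - x0 r) \<longlongrightarrow> x 0 - x0 0) (at_right 0)"
    by (intro tendsto_intros x.tendsto_center x0.tendsto_center)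
  then have "\<forall>\<^sub>F r in at_right 0. 0 < x r - x0 r"
    by (rule order_tendstoD) (use x_0 x0_0 in simp)
  moreover have "\<forall>\<^sub>F r in at_right 0. 0 < r \<and> r < R"
    unfolding eventually_at_right_field using x.R by blast
  ultimately show ?thesis
  proof eventually_elim
    case (elim r)
    then have "x0 r > 0" "deriv x0 r > 0" using x0_pos x0.deriv_pos by auto
    with elim show ?case by (simp add: field_simps)
  qed
qed

end

section \<open>Continuation of the comparison from the centre up to R\<close>

theorem theorem3p2:
  fixes n :: nat and p \<alpha> R :: real
    and f g h :: "nat \<Rightarrow> real \<Rightarrow> real"
    and u v u0 v0 :: "real \<Rightarrow> real"
  assumes "p > 1" and "n \<ge> 2" and "\<alpha> \<ge> 0" and "R > 0"
    and B1_f: "\<And>i. i \<in> {1, 2} \<Longrightarrow>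
        continuous_on {0..} (f i) \<and> mono_on {0..} (f i) \<and> (\<forall>t>0. f i t > 0)"
    and B1_g: "\<And>j. j \<in> {1, 2, 3} \<Longrightarrow>
        continuous_on {0..} (g j) \<and> mono_on {0..} (g j) \<and> (\<forall>t>0. g j t > 0)"
    and B1_h: "\<And>j. j \<in> {1, 2, 3} \<Longrightarrow>
        continuous_on {0..} (h j) \<and> mono_on {0..} (h j) \<and> (\<forall>t>0. h j t > 0)"
    and B2_diff: "\<And>j. j \<in> {1, 2, 3} \<Longrightarrow>
        g j differentiable_on {0..} \<and> h j differentiable_on {0..}"
    and B2_incr: "\<And>j. j \<in> {1, 2} \<Longrightarrow>
        strict_mono_on {0<..} (g j) \<and> strict_mono_on {0<..} (h j)"
    and B3: "\<And>j s. j \<in> {1, 2, 3} \<Longrightarrow> s \<ge> 1 \<Longrightarrow>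
        antimono_on {0<..} (\<lambda>t. g j (s * t) / h j t)"
    and B5: "\<And>j t. j \<in> {1, 2, 3} \<Longrightarrow> t > 0 \<Longrightarrow> g j t \<ge> h j t"
    and sol: "radial_solution n p \<alpha> R (f 1) (f 2) (g 1) (g 2) (g 3) u v"
    and sol0: "radial_solution n p \<alpha> R (f 1) (f 2) (h 1) (h 2) (h 3) u0 v0"
    and nonconst: "nonconstant_radial R u" "nonconstant_radial R v"
    and nonconst0: "nonconstant_radial R u0" "nonconstant_radial R v0"
    and pos: "\<And>r. 0 < r \<Longrightarrow> r < R \<Longrightarrow> u r > 0 \<and> v r > 0"
    and pos0: "\<And>r. 0 < r \<Longrightarrow> r < R \<Longrightarrow> u0 r > 0 \<and> v0 r > 0"
    and "u 0 > 0" and "v 0 > 0" and "u0 0 = 0" and "v0 0 = 0"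
    and lim_u0: "\<exists>L::real. ((\<lambda>r. u0 r / deriv u0 r) \<longlongrightarrow> L) (at_right 0)"
    and lim_v0: "\<exists>L::real. ((\<lambda>r. v0 r / deriv v0 r) \<longlongrightarrow> L) (at_right 0)"
  shows "strict_antimono_on {0<..<R} (\<lambda>r. u r / u0 r) \<and>
         strict_antimono_on {0<..<R} (\<lambda>r. v r / v0 r) \<and>
         strict_antimono_on {0<..<R} (\<lambda>r. deriv u r / deriv u0 r) \<and>
         strict_antimono_on {0<..<R} (\<lambda>r. deriv v r / deriv v0 r)"
proof -
  interpret S: radial_system n p \<alpha> R "f 1" "f 2" "g 1" "g 2" "g 3" u v
    by unfold_locales (use assms(1-4) B1_f B1_g B2_incr sol nonconst pos in auto)
  interpret S0: radial_system n p \<alpha> R "f 1" "f 2" "h 1" "h 2" "h 3" u0 v0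
    by unfold_locales (use assms(1-4) B1_f B1_h B2_incr sol0 nonconst0 pos0 in auto)
  define W where "W r = deriv u r / deriv u0 r" for r
  define Y where "Y r = deriv v r / deriv v0 r" for r
  have h_pos: "h j t > 0" if "j \<in> {1, 2, 3}" "t > 0" for j t
    using B1_h[OF that(1)] that(2) by blast
  have g_mono: "mono_on {0..} (g j)" if "j \<in> {1, 2, 3}" for j
    using B1_g[OF that] by blast
  have W_pos: "W r > 0" and Y_pos: "Y r > 0" if "0 < r" "r < R" for r
    using S.u.deriv_pos S0.u.deriv_pos S.v.deriv_pos S0.v.deriv_pos that by (auto simp: W_def Y_def)

  \<comment> \<open>The bound on v/v0 is assumed in weak form, so that this applies at an endpoint
    reached only as a limit.\<close>
  have slopes: "strict_antimono_on {0<..b} W \<and> strict_antimono_on {0<..b} Y \<and> (\<forall>r\<in>{0<..b}. Y r > 1)"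
    if b: "b < R"
      and ge: "\<And>r. r \<in> {0<..b} \<Longrightarrow> v r / v0 r \<ge> 1"
      and anti: "strict_antimono_on {0<..b} (\<lambda>r. v r / v0 r)" for b
  proof -
    have v0: "\<And>r. r \<in> {0<..b} \<Longrightarrow> v0 r > 0" "mono_on {0<..b} v0"
      using pos0 S0.v.strict_mono b by (auto intro!: monotone_onI simp: less_eq_real_def)
    have u0': "\<And>r. r \<in> {0<..b} \<Longrightarrow> deriv u0 r > 0" "mono_on {0<..b} (deriv u0)"
      using S0.u.deriv_pos S0.deriv_u_strict_mono b
      by (auto intro!: monotone_onI simp: less_eq_real_def)
    define \<kappa> where "\<kappa> = 1 - \<alpha> / (p - 1)"
    define m where "m = real (n - 1) * \<kappa>"
    have \<kappa>: "\<kappa> > 0" using S.exponent_pos by (simp add: \<kappa>_def)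
    define k where "k j r = g j (v r) / h j (v0 r)" for j r
    have k_ge: "k j r \<ge> 1" if "j \<in> {1, 2}" "r \<in> {0<..b}" for j r
    proof -
      have j: "j \<in> {1, 2, 3}" using that by auto
      show ?thesis unfolding k_def
        by (rule quotient_ge_1[OF g_mono[OF j] h_pos[OF j] B5[OF j] v0(1)[OF that(2)] ge[OF that(2)]])
    qed
    have k_anti: "strict_antimono_on {0<..b} (k j)" if "j \<in> {1, 2}" for j
    proof -
      have j: "j \<in> {1, 2, 3}" using that by auto
      show ?thesis unfolding k_def[abs_def]
        by (rule quotient_strict_antimono[OF B3[OF j] conjunct1[OF B2_incr[OF that]] h_pos[OF j] v0 ge anti])
    qed
    have W_flux: "S.u.flux r powr \<kappa> / S0.u.flux r powr \<kappa> = W r powr ((p - 1) * \<kappa>)"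
      if "r \<in> {0<..b}" for r
      using that b S.u.flux_powr_eq[of r \<kappa>] S0.u.flux_powr_eq[of r \<kappa>] S.u.deriv_pos[of r] S0.u.deriv_pos[of r]
      by (simp add: W_def powr_divide)
    have *: "strict_antimono_on {0<..b} (\<lambda>r. S.u.flux r powr \<kappa> / S0.u.flux r powr \<kappa>)
      \<and> (\<forall>r. 0 < r \<longrightarrow> r \<le> b \<longrightarrow> S.u.flux r powr \<kappa> / S0.u.flux r powr \<kappa> > k 1 r)"
    proof -
      have D: "((\<lambda>r. S.u.flux r powr \<kappa>) has_real_derivative
            k 1 r * (\<kappa> * (r powr m * (f 1 r * h 1 (v0 r))))) (at r)"
          "((\<lambda>r. S0.u.flux r powr \<kappa>) has_real_derivative
            \<kappa> * (r powr m * (f 1 r * h 1 (v0 r)))) (at r)"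
          "\<kappa> * (r powr m * (f 1 r * h 1 (v0 r))) > 0"
        if r: "0 < r" "r \<le> b" for r
      proof -
        have r': "0 < r" "r < R" using r b by auto
        have hp: "h 1 (v0 r) > 0" using h_pos pos0[OF r'] by simp
        have "k 1 r * (\<kappa> * (r powr m * (f 1 r * h 1 (v0 r)))) = \<kappa> * (r powr m * (f 1 r * g 1 (v r)))"
          using hp by (simp add: k_def)
        then show "((\<lambda>r. S.u.flux r powr \<kappa>) has_real_derivative
            k 1 r * (\<kappa> * (r powr m * (f 1 r * h 1 (v0 r))))) (at r)"
          using S.has_deriv_u_flux_powr[OF r', folded \<kappa>_def, folded m_def] by (simp only:)
        show "((\<lambda>r. S0.u.flux r powr \<kappa>) has_real_derivative
            \<kappa> * (r powr m * (f 1 r * h 1 (v0 r)))) (at r)"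
          using S0.has_deriv_u_flux_powr[OF r', folded \<kappa>_def, folded m_def] .
        show "\<kappa> * (r powr m * (f 1 r * h 1 (v0 r))) > 0"
          using \<kappa> hp S.f_pos(1)[of r] r by simp
      qed
      have "strict_antimono_on {0<..b} (k 1)" by (rule k_anti) simp
      note L = monotone_lhopital[OF S.u.flux_powr_tendsto_0[OF \<kappa>] S0.u.flux_powr_tendsto_0[OF \<kappa>]
          D(1) D(2) D(3) this]
      show ?thesis by (intro conjI allI impI L)
    qed
    have W_anti: "strict_antimono_on {0<..b} W"
    proof (rule strict_antimono_on_powr_cancel)
      show "strict_antimono_on {0<..b} (\<lambda>r. W r powr ((p - 1) * \<kappa>))"
        using conjunct1[OF *] by (auto simp: monotone_on_def W_flux)
      show "(p - 1) * \<kappa> > 0" using \<kappa> \<open>p > 1\<close> by simp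
      show "W r \<ge> 0" if "r \<in> {0<..b}" for r using W_pos[of r] that b by simp
    qed
    \<comment> \<open>The second conclusion of \<open>monotone_lhopital\<close> bounds a positive
      power of W below by \<open>k 1 r\<close>, which is at least 1.\<close>
    have W_ge: "W r \<ge> 1" if r: "r \<in> {0<..b}" for r
    proof (rule ccontr)
      assume "\<not> W r \<ge> 1"
      then have "W r powr ((p - 1) * \<kappa>) \<le> 1"
        using W_pos[of r] r b \<kappa> \<open>p > 1\<close> by (intro powr_le1) auto
      moreover have "W r powr ((p - 1) * \<kappa>) > k 1 r" using * W_flux[OF r] r by force
      ultimately show False using k_ge[of 1 r] r by simp
    qed
    \<comment> \<open>The quotient of the right-hand sides for v and v0, in which \<open>f 2\<close>
      cancels.\<close>
    define K where "K r = k 2 r * (g 3 (deriv u r) / h 3 (deriv u0 r))" for r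
    have k3_ge: "g 3 (deriv u r) / h 3 (deriv u0 r) \<ge> 1" if "r \<in> {0<..b}" for r
      by (rule quotient_ge_1[OF g_mono h_pos B5 u0'(1)[OF that] W_ge[OF that, unfolded W_def]]) simp_all
    have k3_anti: "antimono_on {0<..b} (\<lambda>r. g 3 (deriv u r) / h 3 (deriv u0 r))"
    proof (rule quotient_antimono[OF B3 g_mono h_pos u0' W_ge[unfolded W_def]])
      show "antimono_on {0<..b} (\<lambda>r. deriv u r / deriv u0 r)"
        using W_anti by (auto simp: monotone_on_def W_def less_eq_real_def)
    qed simp_all
    \<comment> \<open>\<open>g 3\<close> is only nondecreasing, so its factor decreases weakly;
      strictness comes from \<open>k 2\<close>.\<close>
    have K_anti: "strict_antimono_on {0<..b} K"
    proof (rule monotone_onI)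
      fix r s assume rs: "r \<in> {0<..b}" "s \<in> {0<..b}" "r < s"
      show "K r > K s"
        unfolding K_def
        using monotone_onD[OF k_anti[of 2] rs] monotone_onD[OF k3_anti, of r s] rs k_ge[of 2 s] k3_ge[of s]
        by (intro mult_less_le_imp_less) auto
    qed
    have **: "strict_antimono_on {0<..b} (\<lambda>r. S.v.flux r / S0.v.flux r)
      \<and> (\<forall>r. 0 < r \<longrightarrow> r \<le> b \<longrightarrow> S.v.flux r / S0.v.flux r > K r)"
    proof -
      define E where "E r = r ^ (n - 1) * (f 2 r * h 2 (v0 r) * h 3 (deriv u0 r))" for r
      have D: "(S.v.flux has_real_derivative K r * E r) (at r)"
          "(S0.v.flux has_real_derivative E r) (at r)" "E r > 0"
        if r: "0 < r" "r \<le> b" for r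
      proof -
        have r': "0 < r" "r < R" using r b by auto
        have hp: "h 2 (v0 r) > 0" "h 3 (deriv u0 r) > 0"
          using h_pos pos0[OF r'] S0.u.deriv_pos[OF r'] by auto
        have "K r * E r = r ^ (n - 1) * (f 2 r * g 2 (v r) * g 3 (deriv u r))"
          using hp by (simp add: K_def k_def E_def)
        then show "(S.v.flux has_real_derivative K r * E r) (at r)"
          using S.v.has_deriv_flux[OF r'] S.u.deriv_pos[OF r'] by simp
        show "(S0.v.flux has_real_derivative E r) (at r)"
          using S0.v.has_deriv_flux[OF r'] S0.u.deriv_pos[OF r'] by (simp add: E_def)
        show "E r > 0" using hp S.f_pos(2)[of r] r by (simp add: E_def)
      qed
      show ?thesis
        by (intro conjI allI impI
            monotone_lhopital[OF S.v.flux_tendsto_0 S0.v.flux_tendsto_0 D(1) D(2) D(3) K_anti])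
    qed
    have Y_flux: "S.v.flux r / S0.v.flux r = Y r powr (p - 1)" if "r \<in> {0<..b}" for r
      using that b S.v.deriv_pos[of r] S0.v.deriv_pos[of r]
      by (simp add: S.v.flux_def S0.v.flux_def Y_def powr_divide)
    have Y_anti: "strict_antimono_on {0<..b} Y"
    proof (rule strict_antimono_on_powr_cancel)
      show "strict_antimono_on {0<..b} (\<lambda>r. Y r powr (p - 1))"
        using conjunct1[OF **] by (auto simp: monotone_on_def Y_flux)
      show "p - 1 > 0" using \<open>p > 1\<close> by simp
      show "Y r \<ge> 0" if "r \<in> {0<..b}" for r using Y_pos[of r] that b by simp
    qed
    have "Y r > 1" if r: "r \<in> {0<..b}" for r
    proof (rule ccontr)
      assume "\<not> Y r > 1"
      then have "Y r powr (p - 1) \<le> 1"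
        using Y_pos[of r] r b \<open>p > 1\<close> by (intro powr_le1) auto
      moreover have "Y r powr (p - 1) > K r" using ** Y_flux[OF r] r by force
      moreover have "K r \<ge> 1" unfolding K_def by (rule mult_ge1_I[OF k_ge k3_ge[OF r]]) (use r in auto)
      ultimately show False by simp
    qed
    with W_anti Y_anti show ?thesis by blast
  qed

  interpret u: profile_pair n p R u "\<lambda>r. f 1 r * g 1 (v r) * abs_pow \<alpha> (deriv u r)"
      u0 "\<lambda>r. f 1 r * h 1 (v0 r) * abs_pow \<alpha> (deriv u0 r)"
    by unfold_locales (use \<open>u 0 > 0\<close> \<open>u0 0 = 0\<close> in auto)
  interpret v: profile_pair n p R v "\<lambda>r. f 2 r * g 2 (v r) * g 3 \<bar>deriv u r\<bar>"
      v0 "\<lambda>r. f 2 r * h 2 (v0 r) * h 3 \<bar>deriv u0 r\<bar>"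
    by unfold_locales (use \<open>v 0 > 0\<close> \<open>v0 0 = 0\<close> in auto)

  \<comment> \<open>The first part makes v/v0 decrease; the second gives the ratios at least 1 for
    which \<open>B3\<close> applies.\<close>
  define P where "P r \<longleftrightarrow> Y r < v r / v0 r \<and> 1 < v r / v0 r" for r
  obtain L where "((\<lambda>r. v0 r / deriv v0 r) \<longlongrightarrow> L) (at_right 0)"
    using lim_v0 by blast
  then have "\<forall>\<^sub>F r in at_right 0. P r"
    unfolding P_def Y_def using S.deriv_v_tendsto_0 by (rule v.eventually_quotient_gt)
  then obtain d where d: "d > 0" "\<And>r. 0 < r \<Longrightarrow> r < d \<Longrightarrow> P r"
    unfolding eventually_at_right_field by blast

  have P_step: "P b" if b: "0 < b" "b < R" and P: "\<And>r. 0 < r \<Longrightarrow> r < b \<Longrightarrow> P r" for b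
  proof -
    have anti: "strict_antimono_on {0<..b} (\<lambda>r. v r / v0 r)"
      using P by (intro v.quotient_strict_antimono_on b) (auto simp: P_def Y_def)
    \<comment> \<open>At b the bound survives only weakly as a limit; \<open>Y b > 1\<close> makes
      it strict again below.\<close>
    have ge: "v r / v0 r \<ge> 1" if r: "r \<in> {0<..b}" for r
    proof (cases "r = b")
      case False
      then show ?thesis using P[of r] r by (simp add: P_def)
    next
      case True
      have "isCont (\<lambda>r. v r / v0 r) b"
        using v.has_deriv_quotient[OF b] by (rule DERIV_isCont)
      then have "((\<lambda>r. v r / v0 r) \<longlongrightarrow> v b / v0 b) (at_left b)"
        by (simp add: isCont_def filterlim_at_split)
      moreover have "\<forall>\<^sub>F r in at_left b. 1 \<le> v r / v0 r"
        unfolding eventually_at_left_field using P b by (force simp: P_def)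
      ultimately have "1 \<le> v b / v0 b" by (rule tendsto_lowerbound) simp
      then show ?thesis using True by simp
    qed
    have Y: "strict_antimono_on {0<..b} Y" "Y b > 1"
      using slopes[OF b(2) ge anti] b by auto
    have "Y b < v b / v0 b"
      using v.slope_quotient_less[OF b] Y(1) by (simp add: Y_def[abs_def])
    with Y(2) show "P b" by (simp add: P_def)
  qed
  have P: "P r" if r: "0 < r" "r < R" for r
  proof (rule ccontr)
    assume "\<not> P r"
    define A where "A = {s \<in> {0<..<R}. \<not> P s}"
    \<comment> \<open>The first radius at which P could fail; \<open>d\<close> keeps it away from
      the centre.\<close>
    define b where "b = Inf A"
    have rA: "r \<in> A" using \<open>\<not> P r\<close> r by (simp add: A_def)
    have bdd: "bdd_below A" by (auto simp: A_def intro!: bdd_belowI[of _ 0])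
    have "b \<ge> d" unfolding b_def
      using rA d(2) by (intro cInf_greatest) (force simp: A_def)+
    moreover have "b \<le> r" unfolding b_def using rA bdd by (rule cInf_lower)
    ultimately have b: "0 < b" "b < R" using d(1) r by auto
    have "P s" if "0 < s" "s < b" for s
    proof (rule ccontr)
      assume "\<not> P s"
      then have "s \<in> A" using that b by (simp add: A_def)
      then show False using cInf_lower[OF _ bdd, of s] that by (simp add: b_def)
    qed
    with b have Pb: "P b" by (rule P_step)
    have contQ: "isCont (\<lambda>r. v r / v0 r) b"
      using v.has_deriv_quotient[OF b] by (rule DERIV_isCont)
    have contY: "isCont Y b"
      using v.isCont_slope_quotient[OF b] by (simp add: Y_def[abs_def])
    \<comment> \<open>P consists of strict inequalities between functions continuous at b, so it
      persists to the right of b, against the choice of b as an infimum.\<close>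
    have "\<forall>\<^sub>F s in at b. 0 < v s / v0 s - Y s"
      using isCont_diff[OF contQ contY] Pb unfolding isCont_def P_def
      by (intro order_tendstoD) auto
    moreover have "\<forall>\<^sub>F s in at b. 1 < v s / v0 s"
      using contQ Pb unfolding isCont_def P_def by (intro order_tendstoD) auto
    ultimately have "\<forall>\<^sub>F s in at b. P s" by eventually_elim (simp add: P_def)
    then obtain e where e: "e > b" "\<And>s. b < s \<Longrightarrow> s < e \<Longrightarrow> P s"
      unfolding eventually_at_split eventually_at_right_field by blast
    then obtain s where "s \<in> A" "s < e"
      using cInf_lessD[of A e] rA by (auto simp: b_def)
    moreover from \<open>s \<in> A\<close> have "b \<le> s" unfolding b_def using bdd by (rule cInf_lower)
    ultimately show False using e(2)[of s] Pb by (cases "s = b") (auto simp: A_def)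
  qed

  have on_b: "strict_antimono_on {0<..b} (\<lambda>r. u r / u0 r) \<and> strict_antimono_on {0<..b} (\<lambda>r. v r / v0 r)
      \<and> strict_antimono_on {0<..b} W \<and> strict_antimono_on {0<..b} Y" if b: "b < R" for b
  proof -
    have V: "strict_antimono_on {0<..b} (\<lambda>r. v r / v0 r)"
      using P b by (intro v.quotient_strict_antimono_on) (auto simp: P_def Y_def)
    have "v r / v0 r \<ge> 1" if "r \<in> {0<..b}" for r
      using P[of r] that b by (simp add: P_def)
    from slopes[OF b this V] have WY: "strict_antimono_on {0<..b} W" "strict_antimono_on {0<..b} Y"
      by blast+
    have "strict_antimono_on {0<..b} (\<lambda>r. u r / u0 r)"
    proof (rule u.quotient_strict_antimono_on[OF b])
      fix r assume r: "0 < r" "r < b"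
      \<comment> \<open>W is already known to decrease, so the tangent comparison with endpoint r
        gives the sign condition for u/u0 directly.\<close>
      have "strict_antimono_on {0<..r} W"
        using WY(1) by (rule monotone_on_subset) (use r in auto)
      then show "deriv u r / deriv u0 r < u r / u0 r"
        using u.slope_quotient_less[of r] r b by (simp add: W_def[abs_def])
    qed
    with V WY show ?thesis by blast
  qed
  have extend: "strict_antimono_on {0<..<R} F"
    if F: "\<And>b. b < R \<Longrightarrow> strict_antimono_on {0<..b} F" for F :: "real \<Rightarrow> real"
  proof (rule monotone_onI)
    fix a b assume ab: "a \<in> {0<..<R}" "b \<in> {0<..<R}" "a < b"
    then show "F a > F b" using monotone_onD[OF F[of b], of a b] by simp
  qed
  show ?thesis
    using extend on_b unfolding W_def[abs_def] Y_def[abs_def] by meson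
qed

end
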